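(* Let $P=P_1\cdots P_\kappa$ be a product of linear forms as in the context, in the variables $x_1,\dots,x_r$, and let $\alpha=\max_{Q\in S_P}\frac{r-r(Q)}{\kappa-\kappa(Q)}$. Suppose $s\in\mathbb{R}$ and $s>\alpha$. Then the series $$\zeta(P;s)=\sum_{x_1,\dots,x_r=1}^{\infty}P(x_1,\dots,x_r)^{-s}$$ converges.
   Context: Let $r,\kappa\ge 1$. $P=P_1\cdots P_\kappa$ where each $P_i=a_{i1}x_1+a_{i2}x_2+\cdots+a_{ir}x_r$ is a linear polynomial over $\mathbb{R}$ with all $a_{ij}\ge 0$ and, for each $i$, at least one $a_{ij}>0$. It is assumed that each variable $x_j$ occurs with non-zero coefficient in at least one factor $P_i$. For a subset of variables $\{x_{j_1},\dots,x_{j_l}\}$, the subpolynomial $Q=P[j_1,\dots,j_l]$ is the product of those linear factors $P_i$ of $P$ which contain only the variables $x_{j_1},\dots,x_{j_l}$ with a non-zero coefficient. One writes $r(Q)=l$ for the number of variables, and $\kappa(Q)$ for the number of linear factors in $Q$. $S_P$ is the set of all proper subpolynomials of $P$ (those given by proper subsets of the set of variables), including the empty subpolynomial $1$ with no variables and degree $0$ (so $r(1)=\kappa(1)=0$). *)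

theory Defs
  imports "HOL-Analysis.Infinite_Sum" "HOL-Library.FuncSet"
begin

text \<open>
  A product of linear forms, kept in factored form: variables and factors are named by natural
  numbers, and \<open>coeff Q i j\<close> is the coefficient of the variable \<open>x\<^sub>j\<close> in the \<open>i\<close>-th factor. Only the
  coefficients with \<open>i \<in> factors Q\<close> and \<open>j \<in> vars Q\<close> are meaningful. Recording the variable set
  explicitly makes the number of variables of a subpolynomial well-defined even when two sets of
  variables select the same linear factors.
\<close>

record linear_product =
  vars :: "nat set"
  factors :: "nat set"
  coeff :: "nat \<Rightarrow> nat \<Rightarrow> real"

definition linear_product_of :: "nat \<Rightarrow> nat \<Rightarrow> (nat \<Rightarrow> nat \<Rightarrow> real) \<Rightarrow> linear_product" where
  "linear_product_of r \<kappa> a = \<lparr>vars = {1..r}, factors = {1..\<kappa>}, coeff = a\<rparr>"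

definition eval_linear_product :: "linear_product \<Rightarrow> (nat \<Rightarrow> real) \<Rightarrow> real" where
  "eval_linear_product Q x = (\<Prod>i\<in>factors Q. \<Sum>j\<in>vars Q. coeff Q i j * x j)"

definition num_vars :: "linear_product \<Rightarrow> nat" where
  "num_vars Q = card (vars Q)"

definition num_factors :: "linear_product \<Rightarrow> nat" where
  "num_factors Q = card (factors Q)"

definition subpolynomial :: "linear_product \<Rightarrow> nat set \<Rightarrow> linear_product" where
  "subpolynomial P J =
     \<lparr>vars = J,
      factors = {i \<in> factors P. \<forall>j\<in>vars P. coeff P i j \<noteq> 0 \<longrightarrow> j \<in> J},
      coeff = coeff P\<rparr>"

text \<open>
  The choice \<open>J = {}\<close> is included; if every factor of \<open>P\<close> is a nonzero form, it gives the empty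
  subpolynomial \<open>1\<close>, with no variables and no factors.
\<close>

definition proper_subpolynomials :: "linear_product \<Rightarrow> linear_product set" where
  "proper_subpolynomials P = subpolynomial P ` {J. J \<subset> vars P}"

text \<open>
  The denominators below are nonzero as soon as every variable of \<open>P\<close> occurs in some factor, since
  then a proper set of variables misses at least one factor.
\<close>

definition abscissa :: "linear_product \<Rightarrow> real" where
  "abscissa P = Max ((\<lambda>Q. (real (num_vars P) - real (num_vars Q)) /
                          (real (num_factors P) - real (num_factors Q))) ` proper_subpolynomials P)"

end

theory Submission
  imports Defs "HOL-Analysis.Infinite_Set_Sum" "HOL-Analysis.Henstock_Kurzweil_Integration"
begin

text \<open>
  Let \<open>\<alpha>\<close> be the abscissa of \<open>P = L\<^sub>1 \<cdots> L\<^sub>\<kappa>\<close>. The series is compared termwise with a product of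
  zeta series. The key is the pointwise bound
  \<open>x\<^sub>1 \<cdots> x\<^sub>r \<le> (P(x) / C) powr \<alpha>\<close> for all \<open>x\<^sub>j \<ge> 1\<close>, with a constant \<open>C > 0\<close>
  (\<open>prod_le_eval_powr_abscissa\<close>). It gives \<open>P(x) powr (-s) \<le> C powr (-s) * (\<Prod>j. x\<^sub>j powr (-p))\<close>
  with \<open>p = s / \<alpha> > 1\<close>, and the right-hand side is summable because \<open>\<Sum>n. n powr (-p)\<close> converges.

  For the bound, let \<open>c\<close> be a positive lower bound of the nonzero coefficients, and put
  \<open>t\<^sub>j = ln x\<^sub>j\<close> and \<open>y\<^sub>i = ln (L\<^sub>i(x) / c)\<close>. Then \<open>t\<^sub>j \<le> y\<^sub>i\<close> whenever \<open>x\<^sub>j\<close> occurs in \<open>L\<^sub>i\<close>, and the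
  claim, with \<open>C = c ^ \<kappa>\<close>, becomes \<open>\<Sum>j. t\<^sub>j \<le> \<alpha> * (\<Sum>i. y\<^sub>i)\<close>. Writing each sum as the integral over
  a level \<open>u\<close> of the number of terms that are at least \<open>u\<close>, it is enough to compare these
  numbers (\<open>sum_le_of_superlevel_card_le\<close>). At level \<open>u\<close>, take \<open>J = {j. t\<^sub>j < u}\<close>: there are
  \<open>r - |J|\<close> variables with \<open>t\<^sub>j \<ge> u\<close>, and every factor that is not a factor of \<open>P[J]\<close> contains one
  of them, so has \<open>y\<^sub>i \<ge> u\<close>. The inequality \<open>r - |J| \<le> \<alpha> * (\<kappa> - \<kappa>(P[J]))\<close> holds by the definition
  of the abscissa (\<open>card_superlevel_le\<close>, \<open>abscissa_bounds\<close>).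
\<close>

section \<open>A layer-cake comparison of sums\<close>

lemma sum_le_of_superlevel_card_le:
  fixes t :: "'a \<Rightarrow> real" and y :: "'b \<Rightarrow> real" and \<alpha> :: real
  assumes "finite V" "finite F"
    and t: "\<And>j. j \<in> V \<Longrightarrow> t j \<ge> 0" and y: "\<And>i. i \<in> F \<Longrightarrow> y i \<ge> 0"
    and le: "\<And>u. real (card {j \<in> V. u \<le> t j}) \<le> \<alpha> * real (card {i \<in> F. u \<le> y i})"
  shows "(\<Sum>j\<in>V. t j) \<le> \<alpha> * (\<Sum>i\<in>F. y i)"
proof -
  define M where "M = (\<Sum>j\<in>V. t j) + (\<Sum>i\<in>F. y i)"
  have tM: "t j \<le> M" if "j \<in> V" for j
    unfolding M_def using assms that member_le_sum[of j V t] sum_nonneg[of F y] by force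
  have yM: "y i \<le> M" if "i \<in> F" for i
    unfolding M_def using assms that member_le_sum[of i F y] sum_nonneg[of V t] by force
  \<comment> \<open>Layer cake: a value \<open>z k\<close> is the integral of the indicator of \<open>{0..z k}\<close>. The common
      upper limit \<open>M\<close> lets both families be integrated over the same interval.\<close>
  have layer: "((\<lambda>u. real (card {k \<in> K. u \<le> z k})) has_integral (\<Sum>k\<in>K. z k)) {0..M}"
    if "finite K" and z: "\<And>k. k \<in> K \<Longrightarrow> 0 \<le> z k" "\<And>k. k \<in> K \<Longrightarrow> z k \<le> M"
    for K :: "'k set" and z :: "'k \<Rightarrow> real"
  proof -
    have "((\<lambda>u. if u \<in> {0..z k} then 1 else 0 :: real) has_integral z k) {0..M}"
      if "k \<in> K" for k
      using z[OF that] has_integral_const_real[of "1::real" 0 "z k"]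
      by (subst has_integral_restrict) auto
    then have "((\<lambda>u. \<Sum>k\<in>K. if u \<in> {0..z k} then 1 else 0 :: real)
        has_integral (\<Sum>k\<in>K. z k)) {0..M}"
      by (rule has_integral_sum[OF \<open>finite K\<close>])
    moreover have "(\<Sum>k\<in>K. if u \<in> {0..z k} then 1 else 0 :: real) = card {k \<in> K. u \<le> z k}"
      if "u \<in> {0..M}" for u
      using that \<open>finite K\<close> by (simp add: sum.If_cases Int_def)
    ultimately show ?thesis
      by (rule has_integral_eq[rotated])
  qed
  show ?thesis
    by (rule has_integral_le[OF layer has_integral_mult_right[OF layer]])
      (use assms tM yM in auto)
qed

text \<open>
  Here \<open>a i j \<noteq> 0\<close> says that the variable \<open>j\<close> occurs in the factor \<open>i\<close>, and the set of all \<open>i\<close> with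
  \<open>\<forall>j\<in>V. a i j \<noteq> 0 \<longrightarrow> j \<in> J\<close> consists of the factors of the subpolynomial given by \<open>J\<close>.
\<close>

lemma card_superlevel_le:
  fixes \<alpha> :: real
  assumes fin: "finite V" "finite F"
    and dom: "\<And>i j. i \<in> F \<Longrightarrow> j \<in> V \<Longrightarrow> a i j \<noteq> 0 \<Longrightarrow> t j \<le> y i"
    and "\<alpha> \<ge> 0"
    and sub: "\<And>J. J \<subset> V \<Longrightarrow> real (card V) - real (card J)
         \<le> \<alpha> * (real (card F) - real (card {i \<in> F. \<forall>j\<in>V. a i j \<noteq> 0 \<longrightarrow> j \<in> J}))"
  shows "real (card {j \<in> V. u \<le> t j}) \<le> \<alpha> * real (card {i \<in> F. u \<le> (y i :: real)})"
proof (cases "\<exists>j\<in>V. u \<le> t j")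
  case False
  \<comment> \<open>Here \<open>{j \<in> V. t j < u}\<close> is all of \<open>V\<close>, which \<open>sub\<close> does not cover.\<close>
  then have "{j \<in> V. u \<le> t j} = {}" by auto
  then show ?thesis using \<open>\<alpha> \<ge> 0\<close> by (simp del: Collect_empty_eq)
next
  case True
  define J where "J = {j \<in> V. t j < u}"
  define I where "I = {i \<in> F. \<forall>j\<in>V. a i j \<noteq> 0 \<longrightarrow> j \<in> J}"
  have "J \<subset> V"
    using True by (force simp: J_def)
  have "{j \<in> V. u \<le> t j} = V - J"
    by (auto simp: J_def)
  then have "real (card {j \<in> V. u \<le> t j}) = real (card V) - real (card J)"
    using fin by (simp add: J_def card_Diff_subset of_nat_diff card_mono)
  also have "\<dots> \<le> \<alpha> * (real (card F) - real (card I))"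
    unfolding I_def by (rule sub[OF \<open>J \<subset> V\<close>])
  also have "real (card F) - real (card I) = real (card (F - I))"
    using fin by (simp add: I_def card_Diff_subset of_nat_diff card_mono)
  also have "F - I \<subseteq> {i \<in> F. u \<le> y i}"
    using dom by (force simp: I_def J_def)
  then have "\<alpha> * real (card (F - I)) \<le> \<alpha> * real (card {i \<in> F. u \<le> y i})"
    using fin \<open>\<alpha> \<ge> 0\<close> by (intro mult_left_mono) (auto intro: card_mono)
  finally show ?thesis .
qed

section \<open>The abscissa and the pointwise bound\<close>

lemma abscissa_bounds:
  fixes r \<kappa> :: nat and a :: "nat \<Rightarrow> nat \<Rightarrow> real"
  assumes "r \<ge> 1" "\<kappa> \<ge> 1"
    and row: "\<And>i. i \<in> {1..\<kappa>} \<Longrightarrow> \<exists>j\<in>{1..r}. a i j > 0"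
    and col: "\<And>j. j \<in> {1..r} \<Longrightarrow> \<exists>i\<in>{1..\<kappa>}. a i j \<noteq> 0"
  defines "P \<equiv> linear_product_of r \<kappa> a"
  shows "abscissa P > 0"
    and "J \<subset> {1..r} \<Longrightarrow> real (card {1..r}) - real (card J)
      \<le> abscissa P * (real (card {1..\<kappa>})
          - real (card {i \<in> {1..\<kappa>}. \<forall>j\<in>{1..r}. a i j \<noteq> 0 \<longrightarrow> j \<in> J}))"
proof -
  define K where "K J = {i \<in> {1..\<kappa>}. \<forall>j\<in>{1..r}. a i j \<noteq> 0 \<longrightarrow> j \<in> J}" for J
  have ratio: "(real r - real (card J)) / (real \<kappa> - real (card (K J))) \<le> abscissa P"
    if "J \<subset> {1..r}" for J
    unfolding abscissa_def
  proof (rule Max_ge)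
    show "finite ((\<lambda>Q. (real (num_vars P) - real (num_vars Q)) /
                       (real (num_factors P) - real (num_factors Q))) ` proper_subpolynomials P)"
    proof -
      have "finite {J. J \<subset> {1..r}}"
        by (rule finite_subset[of _ "Pow {1..r}"]) auto
      then show ?thesis
        by (simp add: proper_subpolynomials_def P_def linear_product_of_def)
    qed
    have "subpolynomial P J \<in> proper_subpolynomials P"
      using that by (auto simp: proper_subpolynomials_def P_def linear_product_of_def)
    moreover have "num_vars P = r" "num_factors P = \<kappa>" "num_vars (subpolynomial P J) = card J"
      "num_factors (subpolynomial P J) = card (K J)"
      by (auto simp: P_def linear_product_of_def num_vars_def num_factors_def subpolynomial_def K_def)
    ultimately show "(real r - real (card J)) / (real \<kappa> - real (card (K J)))
      \<in> (\<lambda>Q. (real (num_vars P) - real (num_vars Q)) /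
             (real (num_factors P) - real (num_factors Q))) ` proper_subpolynomials P"
      by (metis (no_types, lifting) image_eqI)
  qed
  \<comment> \<open>The empty subpolynomial contributes the positive ratio \<open>r / \<kappa>\<close> to the maximum.\<close>
  have "K {} = {}"
    using row by (force simp: K_def)
  then have "real r / real \<kappa> \<le> abscissa P"
    using ratio[of "{}"] \<open>r \<ge> 1\<close> by (simp add: psubset_eq)
  moreover have "real r / real \<kappa> > 0"
    using assms(1,2) by simp
  ultimately show "abscissa P > 0"
    by linarith
  assume J: "J \<subset> {1..r}"
  \<comment> \<open>A variable outside \<open>J\<close> occurs in some factor, so the denominator is positive.\<close>
  have "K J \<subset> {1..\<kappa>}"
    using J col unfolding K_def by blast
  then have "card (K J) < \<kappa>"
    using psubset_card_mono[of "{1..\<kappa>}" "K J"] by simp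
  then have "real r - real (card J) \<le> abscissa P * (real \<kappa> - real (card (K J)))"
    using ratio[OF J] by (simp add: divide_le_eq)
  then show "real (card {1..r}) - real (card J)
      \<le> abscissa P * (real (card {1..\<kappa>})
          - real (card {i \<in> {1..\<kappa>}. \<forall>j\<in>{1..r}. a i j \<noteq> 0 \<longrightarrow> j \<in> J}))"
    by (simp add: K_def)
qed

lemma exists_positive_lower_bound:
  fixes f :: "'a \<Rightarrow> real"
  assumes "finite A"
  shows "\<exists>c>0. \<forall>x\<in>A. f x > 0 \<longrightarrow> c \<le> f x"
  by (rule exI[of _ "Min (insert 1 (f ` {x \<in> A. f x > 0}))"]) (use assms in auto)

text \<open>
  The positivity of \<open>P(x)\<close> is recorded as well, since the bound is to be raised to a real power and
  \<open>powr\<close> has its usual meaning only on a positive base.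
\<close>

lemma prod_le_eval_powr_abscissa:
  fixes r \<kappa> :: nat and a :: "nat \<Rightarrow> nat \<Rightarrow> real"
  assumes "r \<ge> 1" "\<kappa> \<ge> 1"
    and nonneg: "\<And>i j. i \<in> {1..\<kappa>} \<Longrightarrow> j \<in> {1..r} \<Longrightarrow> a i j \<ge> 0"
    and row: "\<And>i. i \<in> {1..\<kappa>} \<Longrightarrow> \<exists>j\<in>{1..r}. a i j > 0"
    and col: "\<And>j. j \<in> {1..r} \<Longrightarrow> \<exists>i\<in>{1..\<kappa>}. a i j \<noteq> 0"
  defines "P \<equiv> linear_product_of r \<kappa> a"
  obtains C where "C > 0"
    and "\<And>x. (\<And>j. j \<in> {1..r} \<Longrightarrow> x j \<ge> 1) \<Longrightarrow>
           (\<Prod>j=1..r. x j) \<le> (eval_linear_product P x / C) powr abscissa P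
           \<and> eval_linear_product P x > 0"
proof -
  obtain c where "c > 0"
    and c: "\<And>i j. i \<in> {1..\<kappa>} \<Longrightarrow> j \<in> {1..r} \<Longrightarrow> a i j > 0 \<Longrightarrow> c \<le> a i j"
    using exists_positive_lower_bound[of "{1..\<kappa>} \<times> {1..r}" "\<lambda>(i, j). a i j"] by auto
  note bounds = abscissa_bounds[OF assms(1,2) row col, folded P_def]
  have "(\<Prod>j=1..r. x j) \<le> (eval_linear_product P x / c ^ \<kappa>) powr abscissa P
      \<and> eval_linear_product P x > 0"
    if x: "\<And>j. j \<in> {1..r} \<Longrightarrow> x j \<ge> 1" for x
  proof -
    define L where "L i = (\<Sum>j=1..r. a i j * x j)" for i
    have L_ge: "x j \<le> L i / c" if ij: "i \<in> {1..\<kappa>}" "j \<in> {1..r}" "a i j \<noteq> 0" for i j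
    proof -
      have "c * x j \<le> a i j * x j"
        using ij c[of i j] nonneg[of i j] x[of j] by (intro mult_right_mono) auto
      also have "\<dots> \<le> L i"
        unfolding L_def using ij nonneg[of i] x by (intro member_le_sum) (auto simp: order_trans[OF zero_le_one])
      finally show ?thesis
        using \<open>c > 0\<close> by (simp add: field_simps)
    qed
    have L1: "1 \<le> L i / c" if "i \<in> {1..\<kappa>}" for i
      using row[OF that] x L_ge[OF that] by (metis less_irrefl order_trans)
    have Lpos: "L i > 0" if "i \<in> {1..\<kappa>}" for i
      using L1[OF that] \<open>c > 0\<close> by (simp add: field_simps)
    have xne: "x j \<noteq> 0" if "j \<in> {1..r}" for j
      using x[OF that] by linarith
    have Lne: "L i / c \<noteq> 0" if "i \<in> {1..\<kappa>}" for i
      using L1[OF that] by linarith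
    have "(\<Sum>j=1..r. ln (x j)) \<le> abscissa P * (\<Sum>i=1..\<kappa>. ln (L i / c))"
    proof (rule sum_le_of_superlevel_card_le)
      show "real (card {j \<in> {1..r}. u \<le> ln (x j)})
          \<le> abscissa P * real (card {i \<in> {1..\<kappa>}. u \<le> ln (L i / c)})" for u
      proof (rule card_superlevel_le[where a = a, OF _ _ _ _ bounds(2)])
        show "ln (x j) \<le> ln (L i / c)" if "i \<in> {1..\<kappa>}" "j \<in> {1..r}" "a i j \<noteq> 0" for i j
          using L_ge[OF that] x[OF that(2)] by (intro ln_mono) auto
      qed (use bounds(1) in auto)
    qed (use x L1 in auto)
    also have "(\<Sum>i=1..\<kappa>. ln (L i / c)) = ln (\<Prod>i=1..\<kappa>. L i / c)"
      by (rule ln_prod[OF finite_atLeastAtMost Lne, symmetric])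
    also have "(\<Prod>i=1..\<kappa>. L i / c) = eval_linear_product P x / c ^ \<kappa>"
      by (simp add: prod_dividef eval_linear_product_def P_def linear_product_of_def L_def)
    also have "(\<Sum>j=1..r. ln (x j)) = ln (\<Prod>j=1..r. x j)"
      by (rule ln_prod[OF finite_atLeastAtMost xne, symmetric])
    finally have le: "ln (\<Prod>j=1..r. x j) \<le> abscissa P * ln (eval_linear_product P x / c ^ \<kappa>)" .
    have pos: "eval_linear_product P x > 0"
      unfolding eval_linear_product_def P_def linear_product_of_def
      using Lpos by (auto simp: L_def intro!: prod_pos)
    have "(\<Prod>j=1..r. x j) > 0"
      using x by (intro prod_pos) (auto intro: less_le_trans[OF zero_less_one])
    then have "(\<Prod>j=1..r. x j) = exp (ln (\<Prod>j=1..r. x j))"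
      by simp
    also have "\<dots> \<le> exp (abscissa P * ln (eval_linear_product P x / c ^ \<kappa>))"
      using le by simp
    also have "\<dots> = (eval_linear_product P x / c ^ \<kappa>) powr abscissa P"
      using pos \<open>c > 0\<close> by (simp add: powr_def)
    finally show ?thesis
      using pos by simp
  qed
  with that[of "c ^ \<kappa>"] \<open>c > 0\<close> show thesis
    by simp
qed

section \<open>Convergence\<close>

text \<open>
  Absolute summability is meant in the measure-theoretic sense of \<open>Infinite_Set_Sum\<close>, where
  products over \<open>PiE\<close> are summable by Fubini; the name is qualified because \<open>Infinite_Sum\<close> has an
  equivalent notion written in the same way.
\<close>

lemma abs_summable_on_powr_nat:
  fixes p :: real
  assumes "p > 1"
  shows "Infinite_Set_Sum.abs_summable_on
      (\<lambda>n. real n powr (- p)) {1::nat..}"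
proof -
  have "summable (\<lambda>n. real n powr (- p))"
    using assms by (simp add: summable_real_powr_iff)
  then have "Infinite_Set_Sum.abs_summable_on
      (\<lambda>n. real n powr (- p)) (UNIV :: nat set)"
    by (simp add: abs_summable_on_nat_iff')
  then show ?thesis
    by (rule abs_summable_on_subset) auto
qed

theorem theorem2p3:
  fixes r \<kappa> :: nat and a :: "nat \<Rightarrow> nat \<Rightarrow> real" and s :: real
  assumes "r \<ge> 1" and "\<kappa> \<ge> 1"
    and "\<And>i j. i \<in> {1..\<kappa>} \<Longrightarrow> j \<in> {1..r} \<Longrightarrow> a i j \<ge> 0"
    and "\<And>i. i \<in> {1..\<kappa>} \<Longrightarrow> \<exists>j\<in>{1..r}. a i j > 0"
    and "\<And>j. j \<in> {1..r} \<Longrightarrow> \<exists>i\<in>{1..\<kappa>}. a i j \<noteq> 0"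
    and "s > abscissa (linear_product_of r \<kappa> a)"
  shows "(\<lambda>x. eval_linear_product (linear_product_of r \<kappa> a) (\<lambda>j. real (x j)) powr (- s))
           summable_on ({1..r} \<rightarrow>\<^sub>E {1::nat..})"
proof -
  define P where "P = linear_product_of r \<kappa> a"
  define p where "p = s / abscissa P"
  have "abscissa P > 0"
    unfolding P_def using assms(1,2,4,5) by (rule abscissa_bounds(1))
  with assms(6) have "p > 1"
    by (simp add: p_def P_def)
  obtain C where "C > 0" and C: "\<And>x. (\<And>j. j \<in> {1..r} \<Longrightarrow> x j \<ge> 1) \<Longrightarrow>
           (\<Prod>j=1..r. x j) \<le> (eval_linear_product P x / C) powr abscissa P
           \<and> eval_linear_product P x > 0"
    unfolding P_def using prod_le_eval_powr_abscissa[OF assms(1-5)] by blast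
  have "Infinite_Set_Sum.abs_summable_on
      (\<lambda>x. \<Prod>j=1..r. real (x j) powr (- p)) ({1..r} \<rightarrow>\<^sub>E {1::nat..})"
    using \<open>p > 1\<close> by (intro abs_summable_on_prod_PiE abs_summable_on_powr_nat) auto
  then have "Infinite_Set_Sum.abs_summable_on
      (\<lambda>x. C powr (- s) * (\<Prod>j=1..r. real (x j) powr (- p))) ({1..r} \<rightarrow>\<^sub>E {1::nat..})"
    by (rule abs_summable_on_cmult_right)
  then have "Infinite_Set_Sum.abs_summable_on
      (\<lambda>x. eval_linear_product P (\<lambda>j. real (x j)) powr (- s)) ({1..r} \<rightarrow>\<^sub>E {1::nat..})"
  proof (rule abs_summable_on_comparison_test')
    fix x assume "x \<in> {1..r} \<rightarrow>\<^sub>E {1::nat..}"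
    then have x: "real (x j) \<ge> 1" if "j \<in> {1..r}" for j
      using that by (force simp: PiE_iff)
    define E where "E = eval_linear_product P (\<lambda>j. real (x j))"
    have E: "(\<Prod>j=1..r. real (x j)) \<le> (E / C) powr abscissa P" "E > 0"
      using C[of "\<lambda>j. real (x j)"] x by (auto simp: E_def)
    have "(\<Prod>j=1..r. real (x j)) > 0"
      using x by (intro prod_pos) (metis of_nat_0_less_iff less_le_trans zero_less_one)
    have "(E / C) powr (- s) = ((E / C) powr abscissa P) powr (- p)"
      using \<open>abscissa P > 0\<close> by (simp add: powr_powr p_def)
    also have "\<dots> \<le> (\<Prod>j=1..r. real (x j)) powr (- p)"
      using E(1) \<open>(\<Prod>j=1..r. real (x j)) > 0\<close> \<open>p > 1\<close> by (intro powr_mono2') auto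
    also have "\<dots> = (\<Prod>j=1..r. real (x j) powr (- p))"
      by (simp add: prod_powr_distrib)
    finally have "E powr (- s) \<le> C powr (- s) * (\<Prod>j=1..r. real (x j) powr (- p))"
      using E(2) \<open>C > 0\<close> by (simp add: powr_divide field_simps)
    then show "norm (eval_linear_product P (\<lambda>j. real (x j)) powr (- s))
        \<le> C powr (- s) * (\<Prod>j=1..r. real (x j) powr (- p))"
      by (simp add: E_def)
  qed
  then show ?thesis
    unfolding P_def by (rule abs_summable_summable[OF iffD2[OF abs_summable_equivalent]])
qed

end
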